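(* Let $m,n,r,s$ be non-zero integers, and let $X$ and $Y$ be the generalized Baumslag--Solitar trees, with common group $G$, given by the following edge-indexed graphs. The quotient graph of $X$ has two vertices $u,v$, a loop at $u$ whose two ends carry the indices $mnr$ and $r$, and one edge joining $u$ to $v$ with index $rm^2$ at $u$ and index $s$ at $v$. The quotient graph of $Y$ has two vertices $u',v'$, a loop at $v'$ whose two ends carry the indices $mns$ and $s$, and one edge joining $u'$ to $v'$ with index $r$ at $u'$ and index $sn^2$ at $v'$. (The two fundamental groups are identified with a single group $G$ by the explicit elementary deformation described in the context.) If $m \nmid n$ and $n \nmid m$, then the $G$-trees $X$ and $Y$ are not related by slide moves.
   Context: A $G$-tree is a simplicial tree with an action of $G$ by automorphisms without inversions; $G$-trees correspond to graphs of groups with fundamental group $G$ (Bass--Serre theory). $G$-trees are considered up to $G$-isomorphism. A generalized Baumslag--Solitar tree is a $G$-tree all of whose vertex and edge stabilizers are infinite cyclic. Edge-indexed graphs: a graph in which each end of each edge carries a non-zero integer (index). It denotes the graph of groups in which all vertex and edge groups are $\mathbb{Z}$ and the inclusion of an edge group into the vertex group at one of its ends is multiplication by the index at that end. Collapse move: an edge of a graph of groups that is not a loop, with endpoint groups $A$ and $C$ and edge group $C$ (so carrying an amalgamation $A*_C C$), is collapsed to a vertex with group $A$; inclusion maps with target $C$ are composed with $C\hookrightarrow A$. The reverse is an expansion move. These are elementary moves; an elementary deformation is a finite sequence of elementary moves. In edge-indexed graphs: collapsing a non-loop edge with index $k$ at one end and $1$ at the other end multiplies by $k$ every other index at the vertex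 on the index-$1$ side. Slide move: let $e$ be an edge of a graph of groups with edge group $C$, from a vertex with group $A$ to a vertex with group $B$ ($e$ may be a loop), and let $f$ be a different edge having an end at the vertex with group $A$, with edge group $D$, such that $D\subseteq C$ as subgroups of $A$. The slide move of $f$ over $e$ moves that end of $f$ to the vertex with group $B$, with new inclusion $D\subseteq C\hookrightarrow B$. (It is an expansion followed by a collapse, so it does not change the fundamental group.) In edge-indexed graphs: if $e$ has index $a$ at its initial end and $b$ at its other end, and $f$ has an end at the initial vertex of $e$ with index $la$, then after the slide that end of $f$ lies at the terminal vertex of $e$ and has index $lb$ (this includes the case that $e$ is a loop). Two $G$-trees are related by slide moves if some finite sequence of slide moves leads from one to a tree $G$-isomorphic to the other. Identification of the groups. $X$ and $Y$ are related by the following elementary deformation. (1) Expansion from $X$ to the graph with vertices $P,Q,R$ and edges: $a$ from $P$ (index $r$) to $Q$ (index $n$); $b$ from $Q$ (index $m$) to $R$ (index $s$); $c$ from $P$ (index $rm$) to $Q$ (index $1$) (collapsing $c$ gives back $X$). (2) Slide the end of $c$ at $P$ over $a$; now $c$ is a loop at $Q$ with indices $mn$ and $1$. (3) Slide the end of $c$ with index $mn$ over $b$; now $c$ joins $Q$ (index $1$) to $R$ (index $ns$). (4) Collapse $c$; the result is $Y$. *)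

theory Defs
  imports
    "HOL-Algebra.Group_Action"
    "HOL-Algebra.Elementary_Groups"
    "Graph_Theory.Bidirected_Digraph"
    "Graph_Theory.Digraph_Component"
begin

section \<open>Trees with a group action\<close>

text \<open>
  Graphs are taken in the sense of Serre: \<open>base\<close> contains both orientations of every edge, and the
  involution \<open>bar\<close> exchanges them. The action is given on vertices and on oriented edges.
\<close>

record ('g, 'v, 'e) gtree =
  base :: "('v, 'e) pre_digraph"
  bar  :: "'e \<Rightarrow> 'e"
  vact :: "'g \<Rightarrow> 'v \<Rightarrow> 'v"
  eact :: "'g \<Rightarrow> 'e \<Rightarrow> 'e"

abbreviation "tverts T \<equiv> verts (base T)"
abbreviation "tarcs T \<equiv> arcs (base T)"
abbreviation "origin T \<equiv> tail (base T)"
abbreviation "terminus T \<equiv> head (base T)"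

text \<open>
  In a graph containing both orientations of each edge, walking along an edge and back is a
  \<open>cycle\<close> in the sense of the library; hence the library's \<open>tree\<close> cannot be used directly and
  these degenerate cycles have to be allowed. Loops and double edges are still excluded.
\<close>

definition serre_tree :: "('v, 'e) pre_digraph \<Rightarrow> ('e \<Rightarrow> 'e) \<Rightarrow> bool" where
  "serre_tree D i \<longleftrightarrow>
     bidirected_digraph D i \<and> connected D \<and>
     (\<forall>p. pre_digraph.cycle D p \<longrightarrow> (\<exists>e. p = [e, i e]))"

definition is_gtree :: "('g, 'x) monoid_scheme \<Rightarrow> ('g, 'v, 'e) gtree \<Rightarrow> bool" where
  "is_gtree G T \<longleftrightarrow>
     serre_tree (base T) (bar T) \<and>
     group_action G (tverts T) (vact T) \<and>
     group_action G (tarcs T) (eact T) \<and>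
     (\<forall>g\<in>carrier G. \<forall>e\<in>tarcs T.
        origin T (eact T g e) = vact T g (origin T e) \<and>
        eact T g (bar T e) = bar T (eact T g e) \<and>
        eact T g e \<noteq> bar T e)"

abbreviation vstab where "vstab G T x \<equiv> stabilizer G (vact T) x"
abbreviation estab where "estab G T e \<equiv> stabilizer G (eact T) e"
abbreviation vorbit where "vorbit G T x \<equiv> orbit G (vact T) x"
abbreviation eorbit where "eorbit G T e \<equiv> orbit G (eact T) e"

text \<open>All translates of the unoriented edge underlying \<open>e\<close>.\<close>

definition edge_class :: "('g, 'x) monoid_scheme \<Rightarrow> ('g, 'v, 'e) gtree \<Rightarrow> 'e \<Rightarrow> 'e set" where
  "edge_class G T e = eorbit G T e \<union> eorbit G T (bar T e)"

definition gbs_tree :: "('g, 'x) monoid_scheme \<Rightarrow> ('g, 'v, 'e) gtree \<Rightarrow> bool" where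
  "gbs_tree G T \<longleftrightarrow>
     is_gtree G T \<and>
     (\<forall>x\<in>tverts T. G\<lparr>carrier := vstab G T x\<rparr> \<cong> integer_group) \<and>
     (\<forall>e\<in>tarcs T. G\<lparr>carrier := estab G T e\<rparr> \<cong> integer_group)"

definition gtree_isomorphic ::
  "('g, 'x) monoid_scheme \<Rightarrow> ('g, 'v, 'e) gtree \<Rightarrow> ('g, 'w, 'f) gtree \<Rightarrow> bool" where
  "gtree_isomorphic G S T \<longleftrightarrow>
     (\<exists>hv he.
        bij_betw hv (tverts S) (tverts T) \<and>
        bij_betw he (tarcs S) (tarcs T) \<and>
        (\<forall>e\<in>tarcs S. origin T (he e) = hv (origin S e) \<and>
                     terminus T (he e) = hv (terminus S e) \<and>
                     he (bar S e) = bar T (he e)) \<and>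
        (\<forall>g\<in>carrier G. \<forall>x\<in>tverts S. hv (vact S g x) = vact T g (hv x)) \<and>
        (\<forall>g\<in>carrier G. \<forall>e\<in>tarcs S. he (eact S g e) = eact T g (he e)))"

section \<open>Graphs of groups and edge-indexed graphs\<close>

text \<open>Here the underlying graph contains exactly one, arbitrarily chosen, orientation of each edge.\<close>

record ('v, 'e, 'a, 'b) graph_of_groups =
  gbase   :: "('v, 'e) pre_digraph"
  vgroup  :: "'v \<Rightarrow> 'a monoid"
  egroup  :: "'e \<Rightarrow> 'b monoid"
  tail_in :: "'e \<Rightarrow> 'b \<Rightarrow> 'a"
  head_in :: "'e \<Rightarrow> 'b \<Rightarrow> 'a"

record ('v, 'e) edge_indexed_graph =
  ibase      :: "('v, 'e) pre_digraph"
  tail_index :: "'e \<Rightarrow> int"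
  head_index :: "'e \<Rightarrow> int"

definition gog_of :: "('v, 'e) edge_indexed_graph \<Rightarrow> ('v, 'e, int, int) graph_of_groups" where
  "gog_of \<Gamma> =
     \<lparr> gbase = ibase \<Gamma>,
       vgroup = (\<lambda>_. integer_group),
       egroup = (\<lambda>_. integer_group),
       tail_in = (\<lambda>e k. tail_index \<Gamma> e * k),
       head_in = (\<lambda>e k. head_index \<Gamma> e * k) \<rparr>"

text \<open>
  The \<open>G\<close>-tree \<open>T\<close> has quotient graph of groups \<open>\<Gamma>\<close>, where \<open>lV\<close> and \<open>lE\<close> choose a lift to \<open>T\<close> of each
  vertex and each edge of \<open>\<Gamma>\<close>. The lifted edges need not start or end at lifted vertices, so the
  inclusion of an edge group into a vertex group involves a conjugation by an element
  transporting one to the other.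
\<close>

definition quotient_via ::
  "('g, 'x) monoid_scheme \<Rightarrow> ('g, 'v, 'e) gtree \<Rightarrow> ('w, 'f, 'a, 'b) graph_of_groups \<Rightarrow>
   ('w \<Rightarrow> 'v) \<Rightarrow> ('f \<Rightarrow> 'e) \<Rightarrow> bool" where
  "quotient_via G T \<Gamma> lV lE \<longleftrightarrow>
     lV ` verts (gbase \<Gamma>) \<subseteq> tverts T \<and>
     lE ` arcs (gbase \<Gamma>) \<subseteq> tarcs T \<and>
     (\<forall>x\<in>tverts T. \<exists>!v. v \<in> verts (gbase \<Gamma>) \<and> x \<in> vorbit G T (lV v)) \<and>
     (\<forall>x\<in>tarcs T. \<exists>!e. e \<in> arcs (gbase \<Gamma>) \<and> x \<in> edge_class G T (lE e)) \<and>
     (\<exists>\<phi> \<psi>.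
        (\<forall>v\<in>verts (gbase \<Gamma>). \<phi> v \<in> iso (vgroup \<Gamma> v) (G\<lparr>carrier := vstab G T (lV v)\<rparr>)) \<and>
        (\<forall>e\<in>arcs (gbase \<Gamma>). \<psi> e \<in> iso (egroup \<Gamma> e) (G\<lparr>carrier := estab G T (lE e)\<rparr>)) \<and>
        (\<forall>e\<in>arcs (gbase \<Gamma>). \<exists>p\<in>carrier G. \<exists>q\<in>carrier G.
           origin T (lE e) = vact T p (lV (tail (gbase \<Gamma>) e)) \<and>
           terminus T (lE e) = vact T q (lV (head (gbase \<Gamma>) e)) \<and>
           (\<forall>c\<in>carrier (egroup \<Gamma> e).
              \<psi> e c = p \<otimes>\<^bsub>G\<^esub> \<phi> (tail (gbase \<Gamma>) e) (tail_in \<Gamma> e c) \<otimes>\<^bsub>G\<^esub> inv\<^bsub>G\<^esub> p \<and>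
              \<psi> e c = q \<otimes>\<^bsub>G\<^esub> \<phi> (head (gbase \<Gamma>) e) (head_in \<Gamma> e c) \<otimes>\<^bsub>G\<^esub> inv\<^bsub>G\<^esub> q)))"

definition given_by ::
  "('g, 'x) monoid_scheme \<Rightarrow> ('g, 'v, 'e) gtree \<Rightarrow> ('w, 'f) edge_indexed_graph \<Rightarrow> bool" where
  "given_by G T \<Gamma> \<longleftrightarrow> (\<exists>lV lE. quotient_via G T (gog_of \<Gamma>) lV lE)"

section \<open>Moves\<close>

text \<open>
  A move on a graph of groups is described on the tree, performed simultaneously on all translates
  of the edges involved.

  Collapsing \<open>e\<close> identifies two vertices when they are joined by a path of translates of \<open>e\<close>, and
  deletes these translates. The conditions say that the image of \<open>e\<close> in the quotient is not a loop,
  and that the edge group is the whole group at the terminal end. The result \<open>S\<close> is determined up to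
  \<open>G\<close>-isomorphism only; read from \<open>S\<close> to \<open>T\<close> this is an expansion move.
\<close>

definition collapse_move ::
  "('g, 'x) monoid_scheme \<Rightarrow> ('g, 'v, 'e) gtree \<Rightarrow> 'e \<Rightarrow> ('g, 'w, 'f) gtree \<Rightarrow> bool" where
  "collapse_move G T e S \<longleftrightarrow>
     e \<in> tarcs T \<and>
     terminus T e \<notin> vorbit G T (origin T e) \<and>
     estab G T e = vstab G T (terminus T e) \<and>
     (\<exists>hv he.
        hv ` tverts T = tverts S \<and>
        (\<forall>x\<in>tverts T. \<forall>y\<in>tverts T.
           hv x = hv y \<longleftrightarrow> (x, y) \<in> {(origin T f, terminus T f) | f. f \<in> edge_class G T e}\<^sup>*) \<and>
        bij_betw he (tarcs T - edge_class G T e) (tarcs S) \<and>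
        (\<forall>f\<in>tarcs T - edge_class G T e.
           origin S (he f) = hv (origin T f) \<and>
           terminus S (he f) = hv (terminus T f) \<and>
           he (bar T f) = bar S (he f)) \<and>
        (\<forall>g\<in>carrier G. \<forall>x\<in>tverts T. hv (vact T g x) = vact S g (hv x)) \<and>
        (\<forall>g\<in>carrier G. \<forall>f\<in>tarcs T - edge_class G T e. he (eact T g f) = eact S g (he f)))"

text \<open>
  The origin of \<open>f\<close> is slid over \<open>e\<close>, from the origin of \<open>e\<close> to the terminus of \<open>e\<close>. The lifts are
  chosen with a common origin, so \<open>D \<subseteq> C\<close> as subgroups of the group at that vertex becomes inclusion
  of stabilizers. Since \<open>bar T f\<close> is not a translate of \<open>f\<close>, the other end of \<open>f\<close> stays in place.
  The new graph is specified on its own vertices and edges, hence up to \<open>G\<close>-isomorphism.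
\<close>

definition slide_move ::
  "('g, 'x) monoid_scheme \<Rightarrow> ('g, 'v, 'e) gtree \<Rightarrow> 'e \<Rightarrow> 'e \<Rightarrow> ('g, 'v, 'e) gtree \<Rightarrow> bool" where
  "slide_move G T f e T' \<longleftrightarrow>
     e \<in> tarcs T \<and> f \<in> tarcs T \<and>
     f \<notin> edge_class G T e \<and>
     origin T f = origin T e \<and>
     estab G T f \<subseteq> estab G T e \<and>
     tverts T' = tverts T \<and> tarcs T' = tarcs T \<and>
     bar T' = bar T \<and> vact T' = vact T \<and> eact T' = eact T \<and>
     (\<forall>g\<in>carrier G. origin T' (eact T g f) = vact T g (terminus T e)) \<and>
     (\<forall>x\<in>tarcs T - eorbit G T f. origin T' x = origin T x) \<and>
     (\<forall>x\<in>tarcs T. terminus T' x = origin T' (bar T x))"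

definition slide_related ::
  "('g, 'x) monoid_scheme \<Rightarrow> ('g, 'v, 'e) gtree \<Rightarrow> ('g, 'w, 'f) gtree \<Rightarrow> bool" where
  "slide_related G S T \<longleftrightarrow>
     (\<exists>S'. (\<lambda>U U'. \<exists>f e. slide_move G U f e U')\<^sup>*\<^sup>* S S' \<and> gtree_isomorphic G S' T)"

section \<open>The two trees and the deformation relating them\<close>

datatype uv_vertex = Vert_u | Vert_v
datatype uv_edge = Loop | Bridge

definition X_graph :: "int \<Rightarrow> int \<Rightarrow> int \<Rightarrow> int \<Rightarrow> (uv_vertex, uv_edge) edge_indexed_graph" where
  "X_graph m n r s =
     \<lparr> ibase = \<lparr> verts = {Vert_u, Vert_v}, arcs = {Loop, Bridge},
         tail = (\<lambda>_. Vert_u),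
         head = (\<lambda>e. case e of Loop \<Rightarrow> Vert_u | Bridge \<Rightarrow> Vert_v) \<rparr>,
       tail_index = (\<lambda>e. case e of Loop \<Rightarrow> m * n * r | Bridge \<Rightarrow> r * m^2),
       head_index = (\<lambda>e. case e of Loop \<Rightarrow> r | Bridge \<Rightarrow> s) \<rparr>"

definition Y_graph :: "int \<Rightarrow> int \<Rightarrow> int \<Rightarrow> int \<Rightarrow> (uv_vertex, uv_edge) edge_indexed_graph" where
  "Y_graph m n r s =
     \<lparr> ibase = \<lparr> verts = {Vert_u, Vert_v}, arcs = {Loop, Bridge},
         tail = (\<lambda>e. case e of Loop \<Rightarrow> Vert_v | Bridge \<Rightarrow> Vert_u),
         head = (\<lambda>_. Vert_v) \<rparr>,
       tail_index = (\<lambda>e. case e of Loop \<Rightarrow> m * n * s | Bridge \<Rightarrow> r),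
       head_index = (\<lambda>e. case e of Loop \<Rightarrow> s | Bridge \<Rightarrow> s * n^2) \<rparr>"

datatype pqr_vertex = Vert_P | Vert_Q | Vert_R
datatype abc_edge = Edge_a | Edge_b | Edge_c

definition PQR_graph :: "int \<Rightarrow> int \<Rightarrow> int \<Rightarrow> int \<Rightarrow> (pqr_vertex, abc_edge) edge_indexed_graph" where
  "PQR_graph m n r s =
     \<lparr> ibase = \<lparr> verts = {Vert_P, Vert_Q, Vert_R}, arcs = {Edge_a, Edge_b, Edge_c},
         tail = (\<lambda>e. case e of Edge_a \<Rightarrow> Vert_P | Edge_b \<Rightarrow> Vert_Q | Edge_c \<Rightarrow> Vert_P),
         head = (\<lambda>e. case e of Edge_a \<Rightarrow> Vert_Q | Edge_b \<Rightarrow> Vert_R | Edge_c \<Rightarrow> Vert_Q) \<rparr>,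
       tail_index = (\<lambda>e. case e of Edge_a \<Rightarrow> r | Edge_b \<Rightarrow> m | Edge_c \<Rightarrow> r * m),
       head_index = (\<lambda>e. case e of Edge_a \<Rightarrow> n | Edge_b \<Rightarrow> s | Edge_c \<Rightarrow> 1) \<rparr>"

text \<open>
  \<open>X\<close> expands to \<open>T0\<close>; then the end of \<open>c\<close> at \<open>P\<close> is slid over \<open>a\<close>, which brings it to \<open>Q\<close>, and over
  \<open>b\<close>, which brings it to \<open>R\<close>; finally \<open>c\<close> is collapsed, absorbing \<open>Q\<close> into \<open>R\<close>. All trees carry
  actions of the same group, so this fixes the identification of the two fundamental groups.
  Any translates of the lifted edges which share their origin may be used for the slides.
\<close>

definition deformation_via ::
  "('g, 'x) monoid_scheme \<Rightarrow> int \<Rightarrow> int \<Rightarrow> int \<Rightarrow> int \<Rightarrow> ('g, 'v1, 'e1) gtree \<Rightarrow>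
   ('g, 'v, 'e) gtree \<Rightarrow> ('g, 'v, 'e) gtree \<Rightarrow> ('g, 'v, 'e) gtree \<Rightarrow> ('g, 'v2, 'e2) gtree \<Rightarrow> bool"
where
  "deformation_via G m n r s X T0 T1 T2 Y \<longleftrightarrow>
     gbs_tree G T0 \<and>
     (\<exists>lV lE. quotient_via G T0 (gog_of (PQR_graph m n r s)) lV lE \<and>
        collapse_move G T0 (lE Edge_c) X \<and>
        (\<exists>a\<in>eorbit G T0 (lE Edge_a). \<exists>c\<in>eorbit G T0 (lE Edge_c). slide_move G T0 c a T1) \<and>
        (\<exists>b\<in>eorbit G T1 (lE Edge_b). \<exists>c\<in>eorbit G T1 (lE Edge_c). slide_move G T1 c b T2) \<and>
        collapse_move G T2 (lE Edge_c) Y)"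

end

theory Submission
  imports Defs
begin

text \<open>
  Slides starting from \<open>X\<close> have almost no freedom, and what they can reach is never \<open>Y\<close>. At every stage
  the quotient consists of a loop with indices \<open>m n r\<close> and \<open>r\<close>, and a bridge with index
  \<open>r m\<^sup>2 (m n)\<^sup>k\<close> at the vertex of the loop and \<open>s\<close> at its other end, for some \<open>k \<ge> 0\<close>. An end of
  one edge can slide over another edge at the same vertex only if the index of the second divides the
  index of the first. The ends of the loop cannot slide over the bridge, since
  \<open>r m\<^sup>2 (m n)\<^sup>k\<close> divides neither \<open>m n r\<close> nor \<open>r\<close> unless \<open>m\<close> divides \<open>n\<close>. The end of the bridge at the
  free vertex meets no other edge. The remaining end of the bridge can slide around the loop in either
  direction, which multiplies or divides its index by \<open>m n\<close>; from \<open>k = 0\<close> the second direction is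
  blocked, because \<open>m n r\<close> divides \<open>r m\<^sup>2\<close> only if \<open>n\<close> divides \<open>m\<close>.
  
  In \<open>Y\<close> the bridge has index \<open>s n\<^sup>2\<close> at the vertex of the loop and \<open>r\<close> at the other end. The
  indices of a tree are determined up to sign, so an isomorphism would give \<open>\<bar>r\<bar> = \<bar>s\<bar>\<close> and then
  \<open>m\<^sup>2 (m n)\<^sup>k = \<plusminus>n\<^sup>2\<close>, whence \<open>m\<close> divides \<open>n\<close>.
  
  To argue on trees instead of graphs of groups, the index of an oriented edge is read off the
  action: it is \<open>d\<close> if the stabilizer of the edge consists of the \<open>d\<close>-th powers in the stabilizer of its
  origin. This is visibly invariant under the group and under isomorphism, and it turns inclusion of
  edge stabilizers into divisibility (\<open>edge_index_dvd\<close>) and slides into the expected arithmetic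
  (\<open>edge_index_slide\<close>). The step common to all slides is \<open>loop_and_bridge_slide\<close>; the comparison with
  \<open>Y\<close> rests on \<open>loop_and_bridge_unique\<close>.
\<close>

section \<open>Subgroups of powers in an infinite cyclic group\<close>

definition powers_of :: "('g, 'x) monoid_scheme \<Rightarrow> 'g set \<Rightarrow> int \<Rightarrow> 'g set" where
  "powers_of G H d = (\<lambda>h. h [^]\<^bsub>G\<^esub> d) ` H"

context group
begin

lemma hom_integer_group_times:
  assumes "subgroup H G" and "\<phi> \<in> hom integer_group (G\<lparr>carrier := H\<rparr>)"
  shows "\<phi> (d * c) = \<phi> c [^] (d::int)"
proof -
  have "group (G\<lparr>carrier := H\<rparr>)"
    by (simp add: assms(1) subgroup_imp_group)
  then interpret hom: group_hom integer_group "G\<lparr>carrier := H\<rparr>" \<phi>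
    using assms(2) by (simp add: group_hom_def group_hom_axioms_def)
  have "\<phi> c \<in> H" using assms(2) by (auto simp: hom_def)
  moreover have "\<phi> (d * c) = \<phi> c [^]\<^bsub>G\<lparr>carrier := H\<rparr>\<^esub> d"
    using hom.hom_int_pow[of c d] by simp
  ultimately show ?thesis
    using int_pow_consistent[OF assms(1)] by simp
qed

lemma integer_iso_obtain:
  assumes "subgroup H G" and "G\<lparr>carrier := H\<rparr> \<cong> integer_group"
  obtains \<phi> where "\<phi> \<in> hom integer_group (G\<lparr>carrier := H\<rparr>)" and "bij_betw \<phi> UNIV H"
proof -
  interpret H: group "G\<lparr>carrier := H\<rparr>"
    by (simp add: assms(1) subgroup_imp_group)
  obtain \<phi> where "\<phi> \<in> iso integer_group (G\<lparr>carrier := H\<rparr>)"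
    using H.iso_sym[OF assms(2)] by (auto simp: is_iso_def)
  then show thesis by (intro that) (auto simp: iso_def)
qed

text \<open>
  Under an isomorphism of \<open>H\<close> with the integers the two sets become \<open>d\<int>\<close> and \<open>a\<int>\<close>.
\<close>

lemma powers_of_subset_imp_dvd:
  assumes "subgroup H G" and "G\<lparr>carrier := H\<rparr> \<cong> integer_group"
    and "powers_of G H d \<subseteq> powers_of G H a"
  shows "a dvd d"
proof -
  obtain \<phi> where \<phi>: "\<phi> \<in> hom integer_group (G\<lparr>carrier := H\<rparr>)" "bij_betw \<phi> UNIV H"
    using integer_iso_obtain assms(1,2) by blast
  have "\<phi> 1 [^] d \<in> powers_of G H d"
    using \<phi>(2) by (auto simp: powers_of_def bij_betw_def)
  then obtain c where "\<phi> 1 [^] d = \<phi> c [^] a"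
    using assms(3) \<phi>(2) unfolding powers_of_def bij_betw_def by blast
  then have "\<phi> (d * 1) = \<phi> (a * c)"
    by (simp only: hom_integer_group_times[OF assms(1) \<phi>(1)])
  then have "d = a * c"
    using \<phi>(2) by (auto simp: bij_betw_def dest: injD)
  then show ?thesis by simp
qed

lemma powers_of_mult:
  assumes "H \<subseteq> carrier G"
  shows "powers_of G H (a * l) = powers_of G (powers_of G H a) l"
  unfolding powers_of_def image_image using assms by (intro image_cong) (auto simp: int_pow_pow)

lemma conj_int_pow:
  assumes "p \<in> carrier G" "h \<in> carrier G"
  shows "p \<otimes> h [^] (d::int) \<otimes> inv p = (p \<otimes> h \<otimes> inv p) [^] d"
proof -
  have "(\<lambda>h. p \<otimes> h \<otimes> inv p) \<in> hom G G"
    using assms(1) by (intro homI) (auto simp: m_assoc inv_solve_left)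
  then interpret group_hom G G "\<lambda>h. p \<otimes> h \<otimes> inv p"
    by unfold_locales
  show ?thesis using hom_int_pow[OF assms(2)] by simp
qed

lemma powers_of_conj:
  assumes "p \<in> carrier G" "H \<subseteq> carrier G"
  shows "powers_of G ((\<lambda>h. p \<otimes> h \<otimes> inv p) ` H) d = (\<lambda>h. p \<otimes> h \<otimes> inv p) ` powers_of G H d"
  unfolding powers_of_def image_image using assms by (intro image_cong) (auto simp: conj_int_pow)

end

text \<open>
  One inclusion suffices: the other one is the same statement for the inverse of \<open>g\<close> at the
  translated point.
\<close>

lemma (in group_action) stabilizer_translate:
  assumes "g \<in> carrier G" and "x \<in> E"
  shows "stabilizer G \<phi> (\<phi> g x) = (\<lambda>h. g \<otimes> h \<otimes> inv g) ` stabilizer G \<phi> x"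
proof -
  interpret group G using group_hom group_hom.axioms(1) by auto
  have mem: "g \<otimes> h \<otimes> inv g \<in> stabilizer G \<phi> (\<phi> g x)"
    if "g \<in> carrier G" "x \<in> E" "h \<in> stabilizer G \<phi> x" for g h x
  proof -
    have h: "h \<in> carrier G" "\<phi> h x = x" using that(3) by (auto simp: stabilizer_def)
    have "\<phi> (g \<otimes> h \<otimes> inv g) (\<phi> g x) = \<phi> (g \<otimes> h \<otimes> inv g \<otimes> g) x"
      using composition_rule[of x "g \<otimes> h \<otimes> inv g" g] that h by simp
    also have "\<dots> = \<phi> (g \<otimes> h) x" using that h by (simp add: m_assoc)
    also have "\<dots> = \<phi> g x" using composition_rule[of x g h] that h by simp
    finally show ?thesis using that h by (simp add: stabilizer_def)
  qed
  show ?thesis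
  proof (intro subset_antisym subsetI)
    fix k assume k: "k \<in> stabilizer G \<phi> (\<phi> g x)"
    then have "k \<in> carrier G" by (simp add: stabilizer_def)
    have "inv g \<otimes> k \<otimes> inv (inv g) \<in> stabilizer G \<phi> (\<phi> (inv g) (\<phi> g x))"
      using mem[of "inv g" "\<phi> g x" k] k assms element_image by simp
    then have "inv g \<otimes> k \<otimes> g \<in> stabilizer G \<phi> x"
      using orbit_sym_aux assms by simp
    moreover have "k = g \<otimes> (inv g \<otimes> k \<otimes> g) \<otimes> inv g"
      using assms \<open>k \<in> carrier G\<close> by (simp add: m_assoc) (simp add: m_assoc[symmetric])
    ultimately show "k \<in> (\<lambda>h. g \<otimes> h \<otimes> inv g) ` stabilizer G \<phi> x" by blast
  next
    fix k assume "k \<in> (\<lambda>h. g \<otimes> h \<otimes> inv g) ` stabilizer G \<phi> x"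
    then show "k \<in> stabilizer G \<phi> (\<phi> g x)" using mem assms by auto
  qed
qed

lemma (in group_action) orbit_translate:
  assumes "g \<in> carrier G" and "x \<in> E"
  shows "orbit G \<phi> (\<phi> g x) = orbit G \<phi> x"
proof -
  have gx: "\<phi> g x \<in> E" "\<phi> g x \<in> orbit G \<phi> x"
    using element_image assms by (auto simp: orbit_def)
  then have x: "x \<in> orbit G \<phi> (\<phi> g x)" using orbit_sym assms(2) by blast
  have sub: "orbit G \<phi> y \<subseteq> E" if "y \<in> E" for y
    using element_image that by (auto simp: orbit_def)
  show ?thesis
    using orbit_trans[OF assms(2) gx(1) _ gx(2)] orbit_trans[OF gx(1) assms(2) _ x]
      sub[OF assms(2)] sub[OF gx(1)]
    by blast
qed

section \<open>Edge indices in a graph with cyclic vertex stabilizers\<close>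

text \<open>
  The part of the structure of a generalized Baumslag--Solitar tree on which indices depend, chosen so
  that slides preserve it for immediate reasons.
\<close>

locale cyclic_graph_action = group G for G :: "('g, 'x) monoid_scheme" (structure) +
  fixes T :: "('g, 'v, 'e) gtree"
  assumes vertex_action: "group_action G (tverts T) (vact T)"
    and edge_action: "group_action G (tarcs T) (eact T)"
    and origin_in: "e \<in> tarcs T \<Longrightarrow> origin T e \<in> tverts T"
    and bar_in: "e \<in> tarcs T \<Longrightarrow> bar T e \<in> tarcs T"
    and bar_bar: "e \<in> tarcs T \<Longrightarrow> bar T (bar T e) = e"
    and terminus_eq: "e \<in> tarcs T \<Longrightarrow> terminus T e = origin T (bar T e)"
    and origin_act: "g \<in> carrier G \<Longrightarrow> e \<in> tarcs T \<Longrightarrow> origin T (eact T g e) = vact T g (origin T e)"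
    and bar_act: "g \<in> carrier G \<Longrightarrow> e \<in> tarcs T \<Longrightarrow> eact T g (bar T e) = bar T (eact T g e)"
    and no_inversion: "g \<in> carrier G \<Longrightarrow> e \<in> tarcs T \<Longrightarrow> eact T g e \<noteq> bar T e"
    and vstab_cyclic: "x \<in> tverts T \<Longrightarrow> G\<lparr>carrier := vstab G T x\<rparr> \<cong> integer_group"

lemma gbs_tree_cyclic_graph_action:
  assumes "gbs_tree G T"
  shows "cyclic_graph_action G T"
proof -
  have T: "is_gtree G T" using assms by (simp add: gbs_tree_def)
  then have act: "group_action G (tverts T) (vact T)" "group_action G (tarcs T) (eact T)"
    by (simp_all add: is_gtree_def)
  interpret G: group G using act(1) group_action.group_hom group_hom.axioms(1) by blast
  interpret bidirected_digraph "base T" "bar T"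
    using T by (simp add: is_gtree_def serre_tree_def)
  show ?thesis
    using assms T act G.group_axioms
    by (intro cyclic_graph_action.intro cyclic_graph_action_axioms.intro)
       (auto simp: is_gtree_def gbs_tree_def)
qed

text \<open>
  A relation and not a function, because \<open>d\<close> and \<open>- d\<close> describe the same subgroup.
\<close>

definition edge_index :: "('g, 'x) monoid_scheme \<Rightarrow> ('g, 'v, 'e) gtree \<Rightarrow> 'e \<Rightarrow> int \<Rightarrow> bool" where
  "edge_index G T e d \<longleftrightarrow> estab G T e = powers_of G (vstab G T (origin T e)) d"

context cyclic_graph_action
begin

sublocale V: group_action G "tverts T" "vact T" by (rule vertex_action)
sublocale E: group_action G "tarcs T" "eact T" by (rule edge_action)

lemma estab_bar:
  assumes "e \<in> tarcs T"
  shows "estab G T (bar T e) = estab G T e"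
proof -
  have "eact T g (bar T e) = bar T e \<longleftrightarrow> eact T g e = e" if "g \<in> carrier G" for g
    using bar_act[OF that assms] bar_bar[OF assms] bar_bar[of "eact T g e"]
      E.element_image[OF that assms] by auto
  then show ?thesis by (auto simp: stabilizer_def)
qed

lemma terminus_act:
  assumes "g \<in> carrier G" "e \<in> tarcs T"
  shows "terminus T (eact T g e) = vact T g (terminus T e)"
  using assms E.element_image[OF assms]
  by (simp add: terminus_eq bar_act[symmetric] origin_act bar_in)

lemma terminus_in: "e \<in> tarcs T \<Longrightarrow> terminus T e \<in> tverts T"
  by (simp add: terminus_eq origin_in bar_in)

lemma vstab_subset: "vstab G T x \<subseteq> carrier G"
  by (auto simp: stabilizer_def)

lemma edge_index_act:
  assumes "edge_index G T e d" "e \<in> tarcs T" "g \<in> carrier G"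
  shows "edge_index G T (eact T g e) d"
  using assms origin_in
  by (simp add: edge_index_def origin_act E.stabilizer_translate V.stabilizer_translate
      powers_of_conj vstab_subset)

text \<open>
  This is what makes a slide of \<open>f\<close> over \<open>e\<close> impossible for most pairs of edges.
\<close>

lemma edge_index_dvd:
  assumes "edge_index G T e a" "edge_index G T f d" "e \<in> tarcs T"
    and "origin T f = origin T e" "estab G T f \<subseteq> estab G T e"
  shows "a dvd d"
proof (rule powers_of_subset_imp_dvd)
  show "subgroup (vstab G T (origin T e)) G"
    using assms(3) by (intro V.stabilizer_subgroup origin_in)
  show "G\<lparr>carrier := vstab G T (origin T e)\<rparr> \<cong> integer_group"
    using assms(3) by (intro vstab_cyclic origin_in)
  show "powers_of G (vstab G T (origin T e)) d \<subseteq> powers_of G (vstab G T (origin T e)) a"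
    using assms by (simp add: edge_index_def)
qed

lemma edge_index_unique:
  assumes "edge_index G T e a" "edge_index G T e d" "e \<in> tarcs T"
  shows "\<bar>a\<bar> = \<bar>d\<bar>"
  using edge_index_dvd[of e a e d] edge_index_dvd[of e d e a] assms by (intro zdvd_antisym_abs) simp_all

lemma vorbit_act: 
  assumes "g \<in> carrier G" "e \<in> tarcs T"
  shows "vorbit G T (origin T (eact T g e)) = vorbit G T (origin T e)"
    and "vorbit G T (terminus T (eact T g e)) = vorbit G T (terminus T e)"
  using assms by (simp_all add: origin_act terminus_act V.orbit_translate origin_in terminus_in)

lemma edge_class_bar:
  assumes "e \<in> tarcs T" shows "edge_class G T (bar T e) = edge_class G T e"
  using assms by (auto simp: edge_class_def bar_bar)

lemma edge_class_act:
  assumes "g \<in> carrier G" "e \<in> tarcs T" shows "edge_class G T (eact T g e) = edge_class G T e"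
  using assms bar_act[symmetric] bar_in by (simp add: edge_class_def E.orbit_translate)

lemma edge_class_cases:
  assumes "e \<in> edge_class G T l"
  obtains g where "g \<in> carrier G" "e = eact T g l" | g where "g \<in> carrier G" "e = eact T g (bar T l)"
  using assms by (auto simp: edge_class_def orbit_def)

lemma edge_class_eq:
  assumes "e \<in> edge_class G T l" "l \<in> tarcs T"
  shows "edge_class G T e = edge_class G T l"
  using assms(1) by (cases rule: edge_class_cases) (simp_all add: assms edge_class_act edge_class_bar bar_in)

lemma edge_class_self: "e \<in> tarcs T \<Longrightarrow> e \<in> edge_class G T e"
  using E.orbit_refl by (simp add: edge_class_def)

end

section \<open>Slide moves\<close>

text \<open>
  Only the origins of the translates of \<open>f\<close> change, and the new ones are given by an equivariant
  formula.
\<close>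

lemma (in cyclic_graph_action) slide_cyclic_graph_action:
  assumes "slide_move G T f e T'"
  shows "cyclic_graph_action G T'"
proof -
  have e: "e \<in> tarcs T" and f: "f \<in> tarcs T"
    and same[simp]: "tverts T' = tverts T" "tarcs T' = tarcs T" "bar T' = bar T"
      "vact T' = vact T" "eact T' = eact T"
    and of: "\<And>g. g \<in> carrier G \<Longrightarrow> origin T' (eact T g f) = vact T g (terminus T e)"
    and ox: "\<And>x. x \<in> tarcs T \<Longrightarrow> x \<notin> eorbit G T f \<Longrightarrow> origin T' x = origin T x"
    and tx: "\<And>x. x \<in> tarcs T \<Longrightarrow> terminus T' x = origin T' (bar T x)"
    using assms by (auto simp: slide_move_def)
  have orig: "origin T' x \<in> tverts T \<and> origin T' (eact T g x) = vact T g (origin T' x)"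
    if x: "x \<in> tarcs T" and g: "g \<in> carrier G" for x g
  proof (cases "x \<in> eorbit G T f")
    case True
    then obtain h where h: "h \<in> carrier G" "x = eact T h f" by (auto simp: orbit_def)
    then have "eact T g x = eact T (g \<otimes> h) f" using E.composition_rule f g by simp
    then have "origin T' (eact T g x) = vact T (g \<otimes> h) (terminus T e)"
      using of h g by simp
    then show ?thesis
      using V.composition_rule[of "terminus T e" g h] V.element_image[OF h(1)] terminus_in[OF e] h g
      by (simp add: of)
  next
    case False
    then have "eact T g x \<notin> eorbit G T f"
      using E.orbit_trans E.orbit_translate[OF g x] E.orbit_refl x f
      by (metis E.element_image E.orbit_sym g)
    then show ?thesis
      using False ox x g origin_in origin_act E.element_image[OF g x] by simp
  qed
  show ?thesis
    using vertex_action edge_action bar_in bar_bar bar_act no_inversion vstab_cyclic tx orig orig[OF _ one_closed]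
    by (intro cyclic_graph_action.intro cyclic_graph_action_axioms.intro group_axioms) auto
qed

text \<open>
  The stabilizer of \<open>f\<close> consists of the \<open>k\<close>-th powers in the stabilizer of \<open>e\<close>, which in turn consists
  of the \<open>b\<close>-th powers in the stabilizer of the new origin of \<open>f\<close>.
\<close>

lemma (in cyclic_graph_action) edge_index_slide:
  assumes "slide_move G T f e T'"
    and "edge_index G T e a" "edge_index G T (bar T e) b" "edge_index G T f (a * k)"
  shows "edge_index G T' f (b * k)"
proof -
  have e: "e \<in> tarcs T" and f: "f \<in> tarcs T"
    and same: "vact T' = vact T" "eact T' = eact T" and o: "origin T f = origin T e"
    and of: "\<And>g. g \<in> carrier G \<Longrightarrow> origin T' (eact T g f) = vact T g (terminus T e)"
    using assms by (auto simp: slide_move_def)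
  have "vact T \<one> (terminus T e) = terminus T e" "eact T \<one> f = f"
    using V.id_eq_one[symmetric] E.id_eq_one[symmetric] e f terminus_in by simp_all
  then have "origin T' f = terminus T e" using of[of \<one>] by simp
  moreover have "estab G T f = powers_of G (estab G T e) k"
    using assms o by (simp add: edge_index_def powers_of_mult vstab_subset)
  ultimately show ?thesis
    using assms(3) e by (simp add: edge_index_def same estab_bar terminus_eq powers_of_mult vstab_subset)
qed

section \<open>Graphs with one loop and one bridge\<close>

text \<open>
  The bridge is oriented away from the loop: \<open>\<gamma>\<close> is its index at the vertex of the loop, \<open>\<delta>\<close> that at
  the other vertex.
\<close>

definition loop_and_bridge ::
  "('g, 'x) monoid_scheme \<Rightarrow> ('g, 'v, 'e) gtree \<Rightarrow> int \<Rightarrow> int \<Rightarrow> int \<Rightarrow> int \<Rightarrow> bool" where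
  "loop_and_bridge G T \<alpha> \<beta> \<gamma> \<delta> \<longleftrightarrow>
     (\<exists>l\<in>tarcs T. \<exists>b\<in>tarcs T.
        tarcs T \<subseteq> edge_class G T l \<union> edge_class G T b \<and>
        vorbit G T (terminus T l) = vorbit G T (origin T l) \<and>
        vorbit G T (origin T b) = vorbit G T (origin T l) \<and>
        vorbit G T (terminus T b) \<noteq> vorbit G T (origin T l) \<and>
        edge_index G T l \<alpha> \<and> edge_index G T (bar T l) \<beta> \<and>
        edge_index G T b \<gamma> \<and> edge_index G T (bar T b) \<delta>)"

text \<open>
  The orbits of the two endpoints tell the translates of the loop, of the bridge and of the reversed
  bridge apart, and indices are constant on orbits. The loop gives no way to distinguish its two
  orientations, so that its indices may come in either order.
\<close>

lemma (in cyclic_graph_action) loop_and_bridge_arc_cases: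
  assumes l: "l \<in> tarcs T" and b: "b \<in> tarcs T"
    and cover: "tarcs T \<subseteq> edge_class G T l \<union> edge_class G T b"
    and tl: "vorbit G T (terminus T l) = vorbit G T (origin T l)"
    and ob: "vorbit G T (origin T b) = vorbit G T (origin T l)"
    and tb: "vorbit G T (terminus T b) \<noteq> vorbit G T (origin T l)"
    and idx: "edge_index G T l \<alpha>" "edge_index G T (bar T l) \<beta>"
      "edge_index G T b \<gamma>" "edge_index G T (bar T b) \<delta>"
    and e: "e \<in> tarcs T"
  obtains (loop) "edge_class G T e = edge_class G T l"
      "vorbit G T (origin T e) = vorbit G T (origin T l)"
      "vorbit G T (terminus T e) = vorbit G T (origin T l)"
      "edge_index G T e \<alpha> \<and> edge_index G T (bar T e) \<beta> \<or>
       edge_index G T e \<beta> \<and> edge_index G T (bar T e) \<alpha>"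
  | (bridge) "edge_class G T e = edge_class G T b" 
      "vorbit G T (origin T e) = vorbit G T (origin T l)"
      "vorbit G T (terminus T e) \<noteq> vorbit G T (origin T l)"
      "edge_index G T e \<gamma>" "edge_index G T (bar T e) \<delta>"
  | (bridge_bar) "edge_class G T e = edge_class G T b" 
      "vorbit G T (origin T e) \<noteq> vorbit G T (origin T l)"
      "vorbit G T (terminus T e) = vorbit G T (origin T l)"
proof -
  have bar_ends: "origin T (bar T x) = terminus T x" "terminus T (bar T x) = origin T x"
    if "x \<in> tarcs T" for x
    using that by (simp_all add: terminus_eq bar_in bar_bar)
  note simps = vorbit_act edge_index_act bar_in bar_bar bar_act[symmetric] bar_ends
  from e cover consider "e \<in> edge_class G T l" | "e \<in> edge_class G T b" by auto
  then show thesis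
  proof cases
    case 1
    then have "edge_class G T e = edge_class G T l" using l by (rule edge_class_eq)
    with 1 show thesis
      by (cases rule: edge_class_cases) (use l tl idx loop in \<open>auto simp: simps\<close>)
  next
    case 2
    then have c: "edge_class G T e = edge_class G T b" using b by (rule edge_class_eq)
    from 2 show thesis
      by (cases rule: edge_class_cases)
         (use b tb ob idx c bridge bridge_bar in \<open>auto simp: simps\<close>)
  qed
qed

text \<open>
  The loop is the only edge with endpoints in one orbit; hence both descriptions single out the same
  vertex orbit and the same orientation of the bridge.
\<close>

lemma (in cyclic_graph_action) loop_and_bridge_unique:
  assumes "loop_and_bridge G T \<alpha> \<beta> \<gamma> \<delta>" and "loop_and_bridge G T \<alpha>' \<beta>' \<gamma>' \<delta>'"
  shows "\<bar>\<gamma>\<bar> = \<bar>\<gamma>'\<bar>" and "\<bar>\<delta>\<bar> = \<bar>\<delta>'\<bar>"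
proof -
  obtain l b where lb: "l \<in> tarcs T" "b \<in> tarcs T"
    "tarcs T \<subseteq> edge_class G T l \<union> edge_class G T b"
    "vorbit G T (terminus T l) = vorbit G T (origin T l)"
    "vorbit G T (origin T b) = vorbit G T (origin T l)"
    "vorbit G T (terminus T b) \<noteq> vorbit G T (origin T l)"
    "edge_index G T l \<alpha>" "edge_index G T (bar T l) \<beta>"
    "edge_index G T b \<gamma>" "edge_index G T (bar T b) \<delta>"
    using assms(1) unfolding loop_and_bridge_def by blast
  note arc_cases = loop_and_bridge_arc_cases[OF lb]
  obtain l' b' where lb': "l' \<in> tarcs T" "b' \<in> tarcs T"
    "vorbit G T (terminus T l') = vorbit G T (origin T l')"
    "vorbit G T (origin T b') = vorbit G T (origin T l')"
    "vorbit G T (terminus T b') \<noteq> vorbit G T (origin T l')"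
    "edge_index G T b' \<gamma>'" "edge_index G T (bar T b') \<delta>'"
    using assms(2) unfolding loop_and_bridge_def by blast
  have "vorbit G T (origin T l') = vorbit G T (origin T l)"
    using lb'(3) by (cases rule: arc_cases[OF lb'(1)]) auto
  then have "edge_index G T b' \<gamma> \<and> edge_index G T (bar T b') \<delta>"
    using lb'(4,5) by (cases rule: arc_cases[OF lb'(2)]) auto
  then show "\<bar>\<gamma>\<bar> = \<bar>\<gamma>'\<bar>" "\<bar>\<delta>\<bar> = \<bar>\<delta>'\<bar>"
    using edge_index_unique lb'(2,6,7) bar_in by blast+
qed

lemma loop_and_bridge_isomorphic:
  assumes S: "cyclic_graph_action G S" and T: "cyclic_graph_action G T"
    and "gtree_isomorphic G S T" and "loop_and_bridge G S \<alpha> \<beta> \<gamma> \<delta>"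
  shows "loop_and_bridge G T \<alpha> \<beta> \<gamma> \<delta>"
proof -
  interpret S: cyclic_graph_action G S by (rule S)
  interpret T: cyclic_graph_action G T by (rule T)
  obtain hv he where hv: "bij_betw hv (tverts S) (tverts T)" and he: "bij_betw he (tarcs S) (tarcs T)"
    and ends: "\<And>e. e \<in> tarcs S \<Longrightarrow> origin T (he e) = hv (origin S e)"
      "\<And>e. e \<in> tarcs S \<Longrightarrow> terminus T (he e) = hv (terminus S e)"
      "\<And>e. e \<in> tarcs S \<Longrightarrow> bar T (he e) = he (bar S e)"
    and va: "\<And>g x. g \<in> carrier G \<Longrightarrow> x \<in> tverts S \<Longrightarrow> vact T g (hv x) = hv (vact S g x)"
    and ea: "\<And>g e. g \<in> carrier G \<Longrightarrow> e \<in> tarcs S \<Longrightarrow> eact T g (he e) = he (eact S g e)"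
    using assms(3) unfolding gtree_isomorphic_def by auto
  have hvD: "hv x = hv y \<longleftrightarrow> x = y" if "x \<in> tverts S" "y \<in> tverts S" for x y
    using hv that by (auto simp: bij_betw_def inj_on_def)
  have heD: "he x = he y \<longleftrightarrow> x = y" if "x \<in> tarcs S" "y \<in> tarcs S" for x y
    using he that by (auto simp: bij_betw_def inj_on_def)
  have vs: "vstab G T (hv x) = vstab G S x" if "x \<in> tverts S" for x
    using that va hvD S.V.element_image by (auto simp: stabilizer_def)
  have es: "estab G T (he x) = estab G S x" if "x \<in> tarcs S" for x
    using that ea heD S.E.element_image by (auto simp: stabilizer_def)
  have vo: "vorbit G T (hv x) = hv ` vorbit G S x" if "x \<in> tverts S" for x
    unfolding orbit_def Setcompr_eq_image image_image using that va by (intro image_cong) auto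
  have eo: "eorbit G T (he x) = he ` eorbit G S x" if "x \<in> tarcs S" for x
    unfolding orbit_def Setcompr_eq_image image_image using that ea by (intro image_cong) auto
  have vo_sub: "vorbit G S x \<subseteq> tverts S" if "x \<in> tverts S" for x
    using that S.V.element_image by (auto simp: orbit_def)
  have vo_eq: "vorbit G T (hv x) = vorbit G T (hv y) \<longleftrightarrow> vorbit G S x = vorbit G S y"
    if "x \<in> tverts S" "y \<in> tverts S" for x y
    using that vo vo_sub hv
      inj_on_image_eq_iff[of hv "tverts S" "vorbit G S x" "vorbit G S y"]
    by (simp add: bij_betw_def)
  have ec: "edge_class G T (he x) = he ` edge_class G S x" if "x \<in> tarcs S" for x
    using that eo ends S.bar_in by (auto simp: edge_class_def)
  have ei: "edge_index G T (he x) d \<longleftrightarrow> edge_index G S x d" if "x \<in> tarcs S" for x d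
    using that by (simp add: edge_index_def es ends vs S.origin_in)
  obtain l b where lb: "l \<in> tarcs S" "b \<in> tarcs S"
    "tarcs S \<subseteq> edge_class G S l \<union> edge_class G S b"
    "vorbit G S (terminus S l) = vorbit G S (origin S l)"
    "vorbit G S (origin S b) = vorbit G S (origin S l)"
    "vorbit G S (terminus S b) \<noteq> vorbit G S (origin S l)"
    "edge_index G S l \<alpha>" "edge_index G S (bar S l) \<beta>"
    "edge_index G S b \<gamma>" "edge_index G S (bar S b) \<delta>"
    using assms(4) unfolding loop_and_bridge_def by blast
  have "tarcs T = he ` tarcs S" using he by (simp add: bij_betw_def)
  also have "\<dots> \<subseteq> edge_class G T (he l) \<union> edge_class G T (he b)"
    using lb(1-3) by (auto simp: ec)
  finally have "tarcs T \<subseteq> edge_class G T (he l) \<union> edge_class G T (he b)" .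
  moreover have "he l \<in> tarcs T" "he b \<in> tarcs T" using he lb(1,2) by (auto simp: bij_betw_def)
  ultimately show ?thesis
    unfolding loop_and_bridge_def using lb
    by (intro bexI[of _ "he l"] bexI[of _ "he b"])
       (simp_all add: ends ei vo_eq S.origin_in S.terminus_in S.bar_in)
qed

text \<open>
  As \<open>e\<close> and \<open>f\<close> lie in different classes and have a common origin, one of them is a translate of the
  bridge and the other one a translate of the loop in some orientation. The hypotheses on \<open>\<gamma>\<close> rule out
  that the loop moves. The bridge travels around the loop in one of the two directions, and \<open>k\<close> is the
  quotient of its index by the index of the loop at the end where it starts.
\<close>

lemma (in cyclic_graph_action) loop_and_bridge_slide:
  assumes slide: "slide_move G T f e T'"
    and lb: "loop_and_bridge G T \<alpha> \<beta> \<gamma> \<delta>"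
    and no: "\<not> \<gamma> dvd \<alpha>" "\<not> \<gamma> dvd \<beta>"
  shows "\<exists>k. \<gamma> = \<alpha> * k \<and> loop_and_bridge G T' \<alpha> \<beta> (\<beta> * k) \<delta> \<or>
             \<gamma> = \<beta> * k \<and> loop_and_bridge G T' \<alpha> \<beta> (\<alpha> * k) \<delta>"
proof -
  have e: "e \<in> tarcs T" and f: "f \<in> tarcs T" and cl: "f \<notin> edge_class G T e"
    and of: "origin T f = origin T e" and sub: "estab G T f \<subseteq> estab G T e"
    and same: "tarcs T' = tarcs T" "bar T' = bar T" "vact T' = vact T" "eact T' = eact T"
    and o1: "\<And>g. g \<in> carrier G \<Longrightarrow> origin T' (eact T g f) = vact T g (terminus T e)"
    and ox: "\<And>x. x \<in> tarcs T \<Longrightarrow> x \<notin> eorbit G T f \<Longrightarrow> origin T' x = origin T x"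
    and tx: "\<And>x. x \<in> tarcs T \<Longrightarrow> terminus T' x = origin T' (bar T x)"
    using slide by (auto simp: slide_move_def)
  obtain l b where lb: "l \<in> tarcs T" "b \<in> tarcs T"
    "tarcs T \<subseteq> edge_class G T l \<union> edge_class G T b"
    "vorbit G T (terminus T l) = vorbit G T (origin T l)"
    "vorbit G T (origin T b) = vorbit G T (origin T l)"
    "vorbit G T (terminus T b) \<noteq> vorbit G T (origin T l)"
    "edge_index G T l \<alpha>" "edge_index G T (bar T l) \<beta>"
    "edge_index G T b \<gamma>" "edge_index G T (bar T b) \<delta>"
    using lb unfolding loop_and_bridge_def by blast
  note f_cases = loop_and_bridge_arc_cases[OF lb f, case_names loop bridge bridge_bar]
  note e_cases = loop_and_bridge_arc_cases[OF lb e, case_names loop bridge bridge_bar]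
  have diff: "edge_class G T f \<noteq> edge_class G T e"
    using cl edge_class_self[OF f] by auto
  show ?thesis
  proof (cases rule: f_cases)
    case loop
    note f_loop = this
    show ?thesis
    proof (cases rule: e_cases)
      case bridge
      then show ?thesis
        using f_loop(4) edge_index_dvd[OF _ _ e of sub] no by blast
    qed (use f_loop diff of in auto)
  next
    case bridge_bar
    then show ?thesis
      by (cases rule: e_cases) (use diff of in auto)
  next
    case bridge
    note f_bridge = this
    show ?thesis
    proof (cases rule: e_cases)
      case loop
      \<comment> \<open>The edge \<open>f\<close> itself serves as the new bridge, since its new origin is known explicitly.\<close>
      have "vact T \<one> (terminus T e) = terminus T e" "eact T \<one> f = f"
        using V.id_eq_one[symmetric] E.id_eq_one[symmetric] e f terminus_in by simp_all
      then have of': "origin T' f = terminus T e" using o1[of \<one>] by simp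
      have cl': "edge_class G T' = edge_class G T"
        by (simp add: edge_class_def[abs_def] same)
      have fixed: "origin T' x = origin T x" if "edge_class G T x \<noteq> edge_class G T f" "x \<in> tarcs T" for x
        using that ox edge_class_eq[OF _ f] by (auto simp: edge_class_def[of G T f])
      have "edge_class G T l \<noteq> edge_class G T f"
        using loop(1) diff by simp
      then have ol: "origin T' l = origin T l" "origin T' (bar T l) = origin T (bar T l)"
        using fixed lb(1) by (simp_all add: edge_class_bar bar_in)
      have "bar T f \<notin> eorbit G T f" using no_inversion[OF _ f, THEN not_sym] by (auto simp: orbit_def)
      then have obf: "origin T' (bar T f) = origin T (bar T f)"
        using ox f bar_in by simp
      have new: "loop_and_bridge G T' \<alpha> \<beta> d \<delta>" if d: "edge_index G T' f d" for d
        unfolding loop_and_bridge_def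
      proof (rule bexI[of _ l], rule bexI[of _ f], intro conjI)
        show "tarcs T' \<subseteq> edge_class G T' l \<union> edge_class G T' f"
          using lb(3) f_bridge(1) by (simp add: cl' same)
        show "edge_index G T' l \<alpha>" "edge_index G T' (bar T' l) \<beta>"
          "edge_index G T' (bar T' f) \<delta>"
          using lb(7,8) f_bridge(5) by (simp_all add: edge_index_def same ol obf)
        show "vorbit G T' (origin T' f) = vorbit G T' (origin T' l)"
          using loop(3) by (simp add: of' ol same)
        show "vorbit G T' (terminus T' l) = vorbit G T' (origin T' l)"
          using lb(1,4) by (simp add: ol same tx terminus_eq)
        show "vorbit G T' (terminus T' f) \<noteq> vorbit G T' (origin T' l)"
          using f_bridge(3) by (simp add: ol obf same tx f terminus_eq)
      qed (use lb(1) f d in \<open>simp_all add: same\<close>)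
      from loop(4) show ?thesis
      proof
        assume i: "edge_index G T e \<alpha> \<and> edge_index G T (bar T e) \<beta>"
        then obtain k where k: "\<gamma> = \<alpha> * k"
          using edge_index_dvd[OF _ f_bridge(4) e of sub] by (auto elim: dvdE)
        then show ?thesis
          using new edge_index_slide[OF slide, of \<alpha> \<beta> k] i f_bridge(4) by blast
      next
        assume i: "edge_index G T e \<beta> \<and> edge_index G T (bar T e) \<alpha>"
        then obtain k where k: "\<gamma> = \<beta> * k"
          using edge_index_dvd[OF _ f_bridge(4) e of sub] by (auto elim: dvdE)
        then show ?thesis
          using new edge_index_slide[OF slide, of \<beta> \<alpha> k] i f_bridge(4) by blast
      qed
    qed (use f_bridge diff of in auto)
  qed
qed

section \<open>The trees given by the two edge-indexed graphs\<close>

text \<open>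
  The group elements \<open>p\<close> and \<open>q\<close> that move the lifted vertices to the ends of the lifted edge conjugate
  one vertex group to another; taking powers commutes with conjugation, so the indices do not depend
  on the chosen lifts.
\<close>

lemma (in cyclic_graph_action) quotient_edge_index:
  assumes q: "quotient_via G T (gog_of \<Gamma>) lV lE" and e: "e \<in> arcs (ibase \<Gamma>)"
    and ends: "tail (ibase \<Gamma>) e \<in> verts (ibase \<Gamma>)" "head (ibase \<Gamma>) e \<in> verts (ibase \<Gamma>)"
  shows "edge_index G T (lE e) (tail_index \<Gamma> e)" and "edge_index G T (bar T (lE e)) (head_index \<Gamma> e)"
    and "vorbit G T (origin T (lE e)) = vorbit G T (lV (tail (ibase \<Gamma>) e))"
    and "vorbit G T (terminus T (lE e)) = vorbit G T (lV (head (ibase \<Gamma>) e))"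
proof -
  obtain \<phi> \<psi> p q where
    phi: "\<And>v. v \<in> verts (ibase \<Gamma>) \<Longrightarrow> \<phi> v \<in> iso integer_group (G\<lparr>carrier := vstab G T (lV v)\<rparr>)"
    and psi: "\<psi> \<in> iso integer_group (G\<lparr>carrier := estab G T (lE e)\<rparr>)"
    and pq: "p \<in> carrier G" "q \<in> carrier G"
    and o: "origin T (lE e) = vact T p (lV (tail (ibase \<Gamma>) e))"
    and t: "terminus T (lE e) = vact T q (lV (head (ibase \<Gamma>) e))"
    and tail: "\<And>c. \<psi> c = p \<otimes> \<phi> (tail (ibase \<Gamma>) e) (tail_index \<Gamma> e * c) \<otimes> inv p"
    and head: "\<And>c. \<psi> c = q \<otimes> \<phi> (head (ibase \<Gamma>) e) (head_index \<Gamma> e * c) \<otimes> inv q"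
    using q e unfolding quotient_via_def gog_of_def by simp metis
  have l: "lE e \<in> tarcs T" "\<And>v. v \<in> verts (ibase \<Gamma>) \<Longrightarrow> lV v \<in> tverts T"
    using q e by (auto simp: quotient_via_def gog_of_def)
  have im: "range \<psi> = estab G T (lE e)" using psi by (auto simp: iso_def bij_betw_def)
  have pow: "estab G T (lE e) = powers_of G (vstab G T (vact T g (lV v))) d"
    if v: "v \<in> verts (ibase \<Gamma>)" and g: "g \<in> carrier G"
      and eq: "\<And>c. \<psi> c = g \<otimes> \<phi> v (d * c) \<otimes> inv g" for v g d
  proof -
    have "subgroup (vstab G T (lV v)) G" using l(2)[OF v] by (rule V.stabilizer_subgroup)
    then have "\<phi> v (d * c) = \<phi> v c [^] d" for c
      using phi[OF v] hom_integer_group_times by (auto simp: iso_def)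
    then have "estab G T (lE e) = (\<lambda>h. g \<otimes> h \<otimes> inv g) ` powers_of G (range (\<phi> v)) d"
      unfolding im[symmetric] by (auto simp: powers_of_def image_image eq)
    moreover have "range (\<phi> v) = vstab G T (lV v)"
      using phi[OF v] by (auto simp: iso_def bij_betw_def)
    ultimately show ?thesis
      using g l(2)[OF v] by (simp add: V.stabilizer_translate powers_of_conj vstab_subset)
  qed
  show "edge_index G T (lE e) (tail_index \<Gamma> e)"
    using pow[OF ends(1) pq(1) tail] o by (simp add: edge_index_def)
  show "edge_index G T (bar T (lE e)) (head_index \<Gamma> e)"
    using pow[OF ends(2) pq(2) head] t l(1) by (simp add: edge_index_def estab_bar terminus_eq)
  show "vorbit G T (origin T (lE e)) = vorbit G T (lV (tail (ibase \<Gamma>) e))"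
    "vorbit G T (terminus T (lE e)) = vorbit G T (lV (head (ibase \<Gamma>) e))"
    using o t pq l(2) ends by (simp_all add: V.orbit_translate)
qed

lemma (in cyclic_graph_action) quotient_cover:
  assumes "quotient_via G T \<Gamma> lV lE"
  shows "lE ` arcs (gbase \<Gamma>) \<subseteq> tarcs T"
    and "tarcs T \<subseteq> (\<Union>e\<in>arcs (gbase \<Gamma>). edge_class G T (lE e))"
    and "inj_on (\<lambda>v. vorbit G T (lV v)) (verts (gbase \<Gamma>))"
proof -
  have ex: "\<exists>!v. v \<in> verts (gbase \<Gamma>) \<and> x \<in> vorbit G T (lV v)" if "x \<in> tverts T" for x
    using assms that unfolding quotient_via_def by blast
  have "v = w" if "v \<in> verts (gbase \<Gamma>)" "w \<in> verts (gbase \<Gamma>)"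
    "vorbit G T (lV v) = vorbit G T (lV w)" for v w
  proof -
    have "lV v \<in> tverts T" using assms that(1) by (auto simp: quotient_via_def)
    then show ?thesis using ex[of "lV v"] V.orbit_refl[of "lV v"] that by metis
  qed
  then show "inj_on (\<lambda>v. vorbit G T (lV v)) (verts (gbase \<Gamma>))" by (auto simp: inj_on_def)
  show "lE ` arcs (gbase \<Gamma>) \<subseteq> tarcs T" using assms by (simp add: quotient_via_def)
  have "\<forall>x\<in>tarcs T. \<exists>!e. e \<in> arcs (gbase \<Gamma>) \<and> x \<in> edge_class G T (lE e)"
    using assms by (simp add: quotient_via_def)
  then show "tarcs T \<subseteq> (\<Union>e\<in>arcs (gbase \<Gamma>). edge_class G T (lE e))" by blast
qed

lemma X_graph_loop_and_bridge:
  assumes "cyclic_graph_action G X" and "given_by G X (X_graph m n r s)"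
  shows "loop_and_bridge G X (m * n * r) r (r * m^2) s"
proof -
  interpret cyclic_graph_action G X by fact
  obtain lV lE where q: "quotient_via G X (gog_of (X_graph m n r s)) lV lE"
    using assms(2) by (auto simp: given_by_def)
  show ?thesis
    unfolding loop_and_bridge_def
    using quotient_edge_index[OF q, of Loop] quotient_edge_index[OF q, of Bridge] quotient_cover[OF q]
    by (intro bexI[of _ "lE Loop"] bexI[of _ "lE Bridge"])
       (auto simp: X_graph_def gog_of_def inj_on_def)
qed

text \<open>
  Here the loop sits at the head of the bridge, so the bridge is reversed.
\<close>

lemma Y_graph_loop_and_bridge:
  assumes "cyclic_graph_action G Y" and "given_by G Y (Y_graph m n r s)"
  shows "loop_and_bridge G Y (m * n * s) s (s * n^2) r"
proof -
  interpret cyclic_graph_action G Y by fact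
  obtain lV lE where q: "quotient_via G Y (gog_of (Y_graph m n r s)) lV lE"
    using assms(2) by (auto simp: given_by_def)
  have arc: "lE Bridge \<in> tarcs Y" using quotient_cover(1)[OF q] by (simp add: Y_graph_def gog_of_def)
  have "origin Y (bar Y (lE Bridge)) = terminus Y (lE Bridge)"
    "terminus Y (bar Y (lE Bridge)) = origin Y (lE Bridge)"
    using arc by (simp_all add: terminus_eq bar_in bar_bar)
  then show ?thesis
    unfolding loop_and_bridge_def
    using quotient_edge_index[OF q, of Loop] quotient_edge_index[OF q, of Bridge] quotient_cover[OF q]
    by (intro bexI[of _ "lE Loop"] bexI[of _ "bar Y (lE Bridge)"])
       (auto simp: Y_graph_def gog_of_def inj_on_def bar_bar edge_class_bar arc bar_in)
qed

section \<open>The slide class of the first tree\<close>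

text \<open>
  The exponent \<open>k\<close> counts how often the bridge has gone around the loop. Since \<open>n\<close> does not divide \<open>m\<close>,
  the bridge cannot be unwound beyond its initial position, so that a natural number suffices.
\<close>

lemma loop_and_bridge_slides:
  assumes "m \<noteq> 0" "n \<noteq> 0" "r \<noteq> 0" "\<not> m dvd n" "\<not> n dvd m"
    and "(\<lambda>U U'. \<exists>f e. slide_move G U f e U')\<^sup>*\<^sup>* S S'"
    and "cyclic_graph_action G S" and "loop_and_bridge G S (m * n * r) r (r * m^2) s"
  shows "cyclic_graph_action G S' \<and>
    (\<exists>k. loop_and_bridge G S' (m * n * r) r (r * m^2 * (m * n)^k) s)"
  using assms(6)
proof (induction rule: rtranclp_induct)
  case base
  show ?case using assms(7,8) by (auto intro: exI[of _ 0])
next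
  case (step U U')
  from step.hyps(2) obtain f e where slide: "slide_move G U f e U'" by blast
  from step.IH obtain k where U: "cyclic_graph_action G U"
    and lb: "loop_and_bridge G U (m * n * r) r (r * m^2 * (m * n)^k) s" by blast
  have no: "\<not> r * m^2 * (m * n)^k dvd m * n * r" "\<not> r * m^2 * (m * n)^k dvd r"
  proof -
    have "r * m^2 * (m * n)^k dvd m * n * r" if "r * m^2 * (m * n)^k dvd r"
      using that by (rule dvd_mult)
    moreover have "m dvd n" if "r * m^2 * (m * n)^k dvd m * n * r"
    proof -
      have "r * m^2 dvd m * n * r" using that dvd_mult_left by blast
      then have "(m * r) * m dvd (m * r) * n" by (simp add: power2_eq_square ac_simps)
      then show ?thesis using assms(1,3) by simp
    qed
    ultimately show "\<not> r * m^2 * (m * n)^k dvd m * n * r" "\<not> r * m^2 * (m * n)^k dvd r"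
      using assms(4) by blast+
  qed
  have "\<exists>k. loop_and_bridge G U' (m * n * r) r (r * m^2 * (m * n)^k) s"
    using cyclic_graph_action.loop_and_bridge_slide[OF U slide lb no]
  proof (elim exE disjE conjE)
    fix c assume c: "r * m^2 * (m * n)^k = m * n * r * c"
      and lb': "loop_and_bridge G U' (m * n * r) r (r * c) s"
    show ?thesis
    proof (cases k)
      case 0
      then have "(m * r) * m = (m * r) * (n * c)" using c by (simp add: power2_eq_square ac_simps)
      then have "n dvd m" using assms(1,3) by simp
      then show ?thesis using assms(5) by simp
    next
      case (Suc j)
      then have "(m * n) * (r * c) = (m * n) * (r * m^2 * (m * n)^j)"
        using c by (auto simp: ac_simps)
      then have "r * c = r * m^2 * (m * n)^j" using assms(1,2) by auto
      then show ?thesis using lb' by metis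
    qed
  next
    fix c assume c: "r * m^2 * (m * n)^k = r * c"
      and lb': "loop_and_bridge G U' (m * n * r) r (m * n * r * c) s"
    have "m * n * r * c = (m * n) * (r * m^2 * (m * n)^k)" using c by (auto simp: ac_simps)
    also have "\<dots> = r * m^2 * (m * n)^Suc k" by (simp add: ac_simps)
    finally show ?thesis using lb' by metis
  qed
  then show ?case using cyclic_graph_action.slide_cyclic_graph_action[OF U slide] by blast
qed

theorem proposition2p2:
  fixes G :: "('g, 'x) monoid_scheme"
    and m n r s :: int
    and X :: "('g, 'v1, 'e1) gtree"
    and Y :: "('g, 'v2, 'e2) gtree"
    and T0 T1 T2 :: "('g, 'v, 'e) gtree"
  assumes "m \<noteq> 0" and "n \<noteq> 0" and "r \<noteq> 0" and "s \<noteq> 0"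
    and "gbs_tree G X" and "given_by G X (X_graph m n r s)"
    and "gbs_tree G Y" and "given_by G Y (Y_graph m n r s)"
    and "deformation_via G m n r s X T0 T1 T2 Y"
    and "\<not> m dvd n" and "\<not> n dvd m"
  shows "\<not> slide_related G X Y"
proof
  assume "slide_related G X Y"
  then obtain X' where slides: "(\<lambda>U U'. \<exists>f e. slide_move G U f e U')\<^sup>*\<^sup>* X X'"
    and iso: "gtree_isomorphic G X' Y"
    by (auto simp: slide_related_def)
  have X: "cyclic_graph_action G X" and Y: "cyclic_graph_action G Y"
    using assms(5,7) by (simp_all add: gbs_tree_cyclic_graph_action)
  obtain k where X': "cyclic_graph_action G X'"
    and lb: "loop_and_bridge G X' (m * n * r) r (r * m^2 * (m * n)^k) s"
    using loop_and_bridge_slides[OF assms(1-3,10,11) slides X X_graph_loop_and_bridge[OF X assms(6)]]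
    by blast
  note unique = cyclic_graph_action.loop_and_bridge_unique
    [OF Y loop_and_bridge_isomorphic[OF X' Y iso lb] Y_graph_loop_and_bridge[OF Y assms(8)]]
  have "\<bar>r\<bar> * \<bar>m^2 * (m * n)^k\<bar> = \<bar>r\<bar> * \<bar>n^2\<bar>"
    using unique by (simp add: abs_mult ac_simps)
  then have "\<bar>m^2 * (m * n)^k\<bar> = \<bar>n^2\<bar>" using assms(3) by simp
  then have "m^2 dvd n^2" by (metis dvd_abs_iff dvd_triv_left)
  then show False using assms(10) by simp
qed

end
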